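(* Let $n\ge2$ and let $\mathcal D=\{d_1,\ldots,d_M\}\subset\mathbb S^{n-1}$ be finite with $M\ge1$. There exist $F\in\mathrm{SL}(n,\mathbb R)$ and a nonzero trace-free real symmetric $n\times n$ matrix $B$ such that $$\Bigl(\frac{Fd_j}{|Fd_j|}\Bigr)^\top B\Bigl(\frac{Fd_j}{|Fd_j|}\Bigr)<0\qquad(1\le j\le M).$$ Consequently there is no constant $C$ such that $$\|B\|\le C\max_j\Bigl[\Bigl(\frac{Fd_j}{|Fd_j|}\Bigr)^\top B\Bigl(\frac{Fd_j}{|Fd_j|}\Bigr)\Bigr]_+$$ holds for all $F\in\mathrm{SL}(n,\mathbb R)$ and all trace-free real symmetric $n\times n$ matrices $B$.
   Context: $[q]_+=\max(q,0)$; $\|\cdot\|$ is the operator norm; $\mathbb S^{n-1}$ is the unit sphere in $\mathbb R^n$. *)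

theory Defs
  imports "HOL-Analysis.Analysis"
begin

definition SL :: "(real^'n^'n) set" where
  "SL = {F. det F = 1}"

definition tracefree_sym :: "(real^'n^'n) set" where
  "tracefree_sym = {B. transpose B = B \<and> trace B = 0}"

definition opnorm :: "real^'n^'n \<Rightarrow> real" where
  "opnorm B = onorm ((*v) B)"

definition pos_part :: "real \<Rightarrow> real" where
  "pos_part q = max q 0"

definition unit_dir :: "real^'n^'n \<Rightarrow> real^'n \<Rightarrow> real^'n" where
  "unit_dir F d = (F *v d) /\<^sub>R norm (F *v d)"

definition quad_form :: "real^'n^'n \<Rightarrow> real^'n \<Rightarrow> real" where
  "quad_form B u = u \<bullet> (B *v u)"

end

theory Submission
  imports Defs
begin

text \<open>
  Choose a covector q that vanishes on no d j. The linear map that replaces the k-th coordinate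
  of x by t * (q . x) pushes every direction d j towards the k-th axis as t grows, and scaling
  it to determinant 1 does not affect directions. Near that axis the trace-free form
  |u|^2 - n * (u $ k)^2 is negative, because n is at least 2.
\<close>

text \<open>Each nonzero \<open>v\<close> excludes only a hyperplane of covectors, and finitely many
  null sets cannot cover the space.\<close>

lemma exists_covector_nonzero_on_finite:
  fixes S :: "(real^'n) set"
  assumes "finite S" and "0 \<notin> S"
  shows "\<exists>q. \<forall>v\<in>S. v \<bullet> q \<noteq> 0"
proof -
  have "negligible (\<Union>v\<in>S. {q. v \<bullet> q = 0})"
    using assms by (intro negligible_Union) (auto intro!: negligible_hyperplane)
  then have "(\<Union>v\<in>S. {q. v \<bullet> q = 0}) \<noteq> UNIV"
    using non_negligible_UNIV by metis
  then show ?thesis by auto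
qed

definition replace_coord :: "'n \<Rightarrow> real^'n \<Rightarrow> real^'n^'n" where
  "replace_coord k q = (\<chi> i. if i = k then q else axis i 1)"

lemma replace_coord_mult:
  "(replace_coord k q *v x) $ i = (if i = k then q \<bullet> x else x $ i)"
  by (simp add: replace_coord_def matrix_vector_mul_component inner_axis')

lemma det_replace_coord:
  fixes q :: "real^'n"
  shows "det (replace_coord k q) = q $ k"
proof -
  have *: "row i (mat 1 :: real^'n^'n) = axis i 1" for i
    by (simp add: row_def mat_def axis_def vec_eq_iff)
  show ?thesis
    \<comment> \<open>Cramer's rule for the identity: the rows of \<open>mat 1\<close> combined with
      the coordinates of \<open>q\<close> give back \<open>q\<close>, so the determinant is
      \<open>q $ k * det (mat 1)\<close>.\<close>
    using cramer_lemma_transpose[of k q "mat 1"]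
    unfolding * basis_expansion replace_coord_def by simp
qed

lemma det_scaleR: "det (c *\<^sub>R A) = c ^ CARD('n) * det A" for A :: "real^'n^'n"
proof -
  have "c *\<^sub>R A = (\<chi> i. c *s A $ i)"
    by (simp add: vec_eq_iff)
  then show ?thesis
    using det_rows_mul[of "\<lambda>_. c" "\<lambda>i. A $ i"] by simp
qed

lemma exists_SL_scaling:
  fixes A :: "real^'n^'n"
  assumes "det A > 0"
  obtains c where "c > 0" "c *\<^sub>R A \<in> SL"
proof
  let ?c = "root CARD('n) (inverse (det A))"
  show "?c > 0" using assms by simp
  show "?c *\<^sub>R A \<in> SL"
    using assms by (simp add: SL_def det_scaleR real_root_pow_pos2)
qed

lemma unit_dir_scaleR:
  assumes "c > 0"
  shows "unit_dir (c *\<^sub>R A) x = unit_dir A x"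
  using assms by (simp add: unit_dir_def flip: scaleR_matrix_vector_assoc)

text \<open>Homogeneity of degree 2. If \<open>A *v x = 0\<close>, both sides are 0 by the
  conventions for division by zero.\<close>

lemma quad_form_unit_dir:
  "quad_form B (unit_dir A x) = quad_form B (A *v x) / (norm (A *v x))\<^sup>2"
  by (simp add: quad_form_def unit_dir_def matrix_vector_mult_scaleR power2_eq_square divide_simps)

text \<open>The identity minus n times the orthogonal projection onto the k-th axis; the factor n
  makes the trace vanish.\<close>

definition axis_form :: "'n \<Rightarrow> real^'n^'n" where
  "axis_form k = (\<chi> i j. if i = j then (if i = k then 1 - real CARD('n) else 1) else 0)"

lemma axis_form_tracefree_sym: "(axis_form k :: real^'n^'n) \<in> tracefree_sym"
proof -
  have "trace (axis_form k :: real^'n^'n) = (\<Sum>i\<in>UNIV. 1 - (if i = k then real CARD('n) else 0))"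
    unfolding trace_def axis_form_def by (intro sum.cong) auto
  also have "\<dots> = 0" by (simp add: sum_subtractf)
  finally show ?thesis
    by (auto simp: tracefree_sym_def axis_form_def transpose_def vec_eq_iff)
qed

lemma quad_form_axis_form:
  fixes x :: "real^'n"
  shows "quad_form (axis_form k) x = (norm x)\<^sup>2 - real CARD('n) * (x $ k)\<^sup>2"
proof -
  have "(\<Sum>j\<in>UNIV. (if i = j then c else 0) * x $ j) = c * x $ i" for c i
    by (simp add: if_distrib[of "\<lambda>a. a * _"] cong: if_cong)
  then have "(axis_form k *v x) $ i = x $ i - (if i = k then real CARD('n) * x $ k else 0)" for i
    by (simp add: axis_form_def matrix_vector_mult_def algebra_simps)
  then have "axis_form k *v x = x - axis k (real CARD('n) * x $ k)"
    by (simp add: vec_eq_iff axis_def)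
  then show ?thesis
    by (simp add: quad_form_def inner_diff_right inner_axis dot_square_norm)
      (simp add: power2_eq_square)
qed

text \<open>For the image y, |y|^2 = |x|^2 - (x $ k)^2 + (q . x)^2 < 2 (q . x)^2 <= n (y $ k)^2. The
  bound on \<open>norm x\<close> supplies the strictness, which is essential when n = 2.\<close>

lemma quad_form_axis_form_replace_coord_neg:
  fixes q x :: "real^'n"
  assumes "CARD('n) \<ge> 2" and "norm x < \<bar>q \<bullet> x\<bar>"
  shows "quad_form (axis_form k) (unit_dir (replace_coord k q) x) < 0"
proof -
  define y where "y = replace_coord k q *v x"
  have yk: "y $ k = q \<bullet> x"
    by (simp add: y_def replace_coord_mult)
  have y: "y = x + axis k (q \<bullet> x - x $ k)"
    by (simp add: vec_eq_iff y_def replace_coord_mult axis_def)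
  have "(norm y)\<^sup>2 = (norm x)\<^sup>2 + 2 * (q \<bullet> x - x $ k) * x $ k + (q \<bullet> x - x $ k)\<^sup>2"
    unfolding y power2_norm_eq_inner
    by (simp add: inner_add_left inner_add_right inner_axis inner_axis' power2_eq_square algebra_simps)
  then have "(norm y)\<^sup>2 = (norm x)\<^sup>2 + (q \<bullet> x)\<^sup>2 - (x $ k)\<^sup>2"
    by (simp add: power2_eq_square algebra_simps)
  moreover have "(norm x)\<^sup>2 < (q \<bullet> x)\<^sup>2"
    using power_strict_mono[OF assms(2), of 2] by simp
  moreover have "2 * (q \<bullet> x)\<^sup>2 \<le> real CARD('n) * (q \<bullet> x)\<^sup>2"
    using assms(1) by (intro mult_right_mono) auto
  ultimately have "quad_form (axis_form k) y < 0"
    unfolding quad_form_axis_form yk by (smt (verit) zero_le_power2)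
  \<comment> \<open>Needed to keep the inequality strict after dividing by
    \<open>(norm y)\<^sup>2\<close>.\<close>
  moreover have "y \<noteq> 0"
    using assms(2) yk by (metis abs_zero norm_not_less_zero zero_index)
  ultimately show ?thesis
    by (simp add: quad_form_unit_dir y_def divide_neg_pos)
qed

theorem theorem6p1:
  fixes d :: "nat \<Rightarrow> real^'n" and M :: nat
  assumes "CARD('n) \<ge> 2"
    and "M \<ge> 1"
    and "\<And>j. j \<in> {1..M} \<Longrightarrow> d j \<in> sphere 0 1"
  shows "(\<exists>F\<in>SL. \<exists>B\<in>tracefree_sym. B \<noteq> 0 \<and>
            (\<forall>j\<in>{1..M}. quad_form B (unit_dir F (d j)) < 0)) \<and>
         \<not> (\<exists>C::real. \<forall>F\<in>SL. \<forall>B\<in>tracefree_sym.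
            opnorm B \<le> C * (MAX j\<in>{1..M}. pos_part (quad_form B (unit_dir F (d j)))))"
proof -
  fix k :: 'n
  let ?J = "{1..M}"
  have norm_d: "norm (d j) = 1" if "j \<in> ?J" for j
    using assms(3)[OF that] by simp
  \<comment> \<open>Including \<open>axis k 1\<close> forces \<open>q $ k \<noteq> 0\<close>, so
    that the determinant of the coordinate replacement is nonzero.\<close>
  have "\<exists>q. \<forall>v\<in>insert (axis k 1) (d ` ?J). v \<bullet> q \<noteq> 0"
    using norm_d by (intro exists_covector_nonzero_on_finite) (force simp: axis_eq_0_iff)+
  then obtain q where q: "q $ k \<noteq> 0" "\<And>j. j \<in> ?J \<Longrightarrow> d j \<bullet> q \<noteq> 0"
    by (auto simp: inner_axis')
  define \<delta> where "\<delta> = (MIN j\<in>?J. \<bar>d j \<bullet> q\<bar>)"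
  have \<delta>: "\<delta> > 0" "\<And>j. j \<in> ?J \<Longrightarrow> \<delta> \<le> \<bar>d j \<bullet> q\<bar>"
    using q(2) assms(2) by (auto simp: \<delta>_def)
  \<comment> \<open>The sign makes \<open>p $ k\<close> positive, hence the determinant too; the
    factor 2 / \<open>\<delta>\<close> gives |p . d j| >= 2 > 1 = |d j|.\<close>
  define p where "p = (2 * sgn (q $ k) / \<delta>) *\<^sub>R q"
  have "p $ k > 0"
    using q(1) \<delta>(1) by (auto simp: p_def sgn_if)
  then obtain c where c: "c > 0" "c *\<^sub>R replace_coord k p \<in> SL"
    by (metis exists_SL_scaling det_replace_coord)
  have "norm (d j) < \<bar>p \<bullet> d j\<bar>" if "j \<in> ?J" for j
    using norm_d[OF that] \<delta>(1) \<delta>(2)[OF that] q(1)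
    by (simp add: p_def abs_mult abs_sgn_eq inner_commute field_simps)
  then have neg: "quad_form (axis_form k) (unit_dir (c *\<^sub>R replace_coord k p) (d j)) < 0"
    if "j \<in> ?J" for j
    using that assms(1) c(1) by (simp add: unit_dir_scaleR quad_form_axis_form_replace_coord_neg)
  \<comment> \<open>The zero matrix could not be negative at \<open>d 1\<close>, which is available
    because M >= 1.\<close>
  then have nz: "axis_form k \<noteq> 0"
    using assms(2) by (force simp: quad_form_def)
  have "pos_part (quad_form (axis_form k) (unit_dir (c *\<^sub>R replace_coord k p) (d j))) = 0"
    if "j \<in> ?J" for j
    using neg[OF that] by (simp add: pos_part_def)
  \<comment> \<open>This single pair refutes every \<open>C\<close>: the right-hand side is
    \<open>C * 0\<close>, whereas the operator norm of a nonzero matrix is positive.\<close>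
  then have "(MAX j\<in>?J. pos_part (quad_form (axis_form k)
      (unit_dir (c *\<^sub>R replace_coord k p) (d j)))) = 0"
    using assms(2) by (simp cong: image_cong_simp)
  moreover have "opnorm (axis_form k) > 0"
    using nz by (simp add: opnorm_def onorm_pos_lt matrix_vector_mul_bounded_linear matrix_eq)
  ultimately show ?thesis
    using c(2) neg nz axis_form_tracefree_sym[of k]
    by (metis less_le_not_le mult_zero_right)
qed

end
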